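(* Let $(\mathcal{C},d_{\mathcal{C}})$ be a Hilbert geometry in $\mathbb{R}^n$ which is bi-Lipschitz equivalent to an $n$-dimensional normed vector space. Then $\mathcal{C}$ is a polytope.
   Context: A Hilbert geometry $(\mathcal{C},d_{\mathcal{C}})$ in $\mathbb{R}^n$ is a nonempty open convex set $\mathcal{C}\subset\mathbb{R}^n$ that contains no whole line, endowed with the Hilbert distance: $d_{\mathcal{C}}(p,p)=0$, and for distinct $p,q\in\mathcal{C}$, if the line $pq$ meets $\partial\mathcal{C}$ at $a,b$ with $a,p,q,b$ in this order on the line, $$d_{\mathcal{C}}(p,q)=\frac12\ln\left(\frac{\|q-a\|}{\|p-a\|}\cdot\frac{\|p-b\|}{\|q-b\|}\right),$$ where $\|\cdot\|$ is the Euclidean norm; if $a$ or $b$ is at infinity the corresponding ratio is taken equal to $1$. Bi-Lipschitz equivalent means that there is a bijection $\phi:\mathcal{C}\to V$ onto the normed space $(V,\|\cdot\|_V)$ and a constant $L\ge1$ with $L^{-1}d_{\mathcal{C}}(p,q)\le\|\phi(p)-\phi(q)\|_V\le L\,d_{\mathcal{C}}(p,q)$ for all $p,q\in\mathcal{C}$. Polytope convention: since Hilbert geometries are invariant under projective maps, $\mathcal{C}$ is called a polytope if it is the interior of a bounded convex polytope with nonempty interior, or the image of such an interior under a projective transformation (well defined on it). *)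

theory Defs
  imports "HOL-Analysis.Analysis"
begin

definition hilbert_domain :: "(real ^ 'n) set \<Rightarrow> bool" where
  "hilbert_domain C \<longleftrightarrow>
     C \<noteq> {} \<and> open C \<and> convex C \<and> (\<forall>x y. x \<noteq> y \<longrightarrow> \<not> affine hull {x, y} \<subseteq> C)"

(* For distinct p, q in an open convex C, the ray from p through q contains at most one boundary
   point b, and b then lies strictly beyond q. If there is none, b is at infinity and the
   ratio is 1. *)
definition boundary_ratio :: "(real ^ 'n) set \<Rightarrow> real ^ 'n \<Rightarrow> real ^ 'n \<Rightarrow> real" where
  "boundary_ratio C p q =
     (if \<exists>b\<in>frontier C. q \<in> open_segment p b
      then let b = (THE b. b \<in> frontier C \<and> q \<in> open_segment p b)
           in norm (p - b) / norm (q - b)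
      else 1)"

(* The factor for the endpoint a, which lies beyond p on the ray from q, is
   boundary_ratio C q p. *)
definition hilbert_dist :: "(real ^ 'n) set \<Rightarrow> real ^ 'n \<Rightarrow> real ^ 'n \<Rightarrow> real" where
  "hilbert_dist C p q =
     (if p = q then 0 else 1 / 2 * ln (boundary_ratio C q p * boundary_ratio C p q))"

definition bilipschitz_onto_normed ::
    "(real ^ 'n) set \<Rightarrow> (real ^ 'n \<Rightarrow> 'v::real_normed_vector) \<Rightarrow> bool" where
  "bilipschitz_onto_normed C \<phi> \<longleftrightarrow>
     bij_betw \<phi> C UNIV \<and>
     (\<exists>L\<ge>1. \<forall>p\<in>C. \<forall>q\<in>C.
        inverse L * hilbert_dist C p q \<le> norm (\<phi> p - \<phi> q) \<and>
        norm (\<phi> p - \<phi> q) \<le> L * hilbert_dist C p q)"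

(* A projective transformation of the n-dimensional projective space is induced by a linear
   automorphism F of the homogeneous coordinate space; a point x of the affine chart has
   homogeneous coordinates (x, 1). It is well defined on S, as a map to the affine chart, if it
   sends no point of S to the hyperplane at infinity, where the last coordinate vanishes. *)
definition projective_map ::
    "((real ^ 'n) \<times> real \<Rightarrow> (real ^ 'n) \<times> real) \<Rightarrow> real ^ 'n \<Rightarrow> real ^ 'n" where
  "projective_map F x = fst (F (x, 1)) /\<^sub>R snd (F (x, 1))"

definition projective_on ::
    "(real ^ 'n) set \<Rightarrow> ((real ^ 'n) \<times> real \<Rightarrow> (real ^ 'n) \<times> real) \<Rightarrow> bool" where
  "projective_on S F \<longleftrightarrow> linear F \<and> bij F \<and> (\<forall>x\<in>S. snd (F (x, 1)) \<noteq> 0)"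

definition polytopal_domain :: "(real ^ 'n) set \<Rightarrow> bool" where
  "polytopal_domain C \<longleftrightarrow>
     (\<exists>P. polytope P \<and> interior P \<noteq> {} \<and>
        (C = interior P \<or>
         (\<exists>F. projective_on (interior P) F \<and> C = projective_map F ` interior P)))"

end

theory Submission
  imports Defs
begin

text \<open>
  A normed space of dimension \<open>n\<close> has bounded packing: for a fixed \<open>L\<close> the number of points in the ball of
  radius \<open>L\<close> with mutual distances at least \<open>1 / (4 L)\<close> is bounded.  A Hilbert geometry offers as many
  well-separated directions as its closure has exposed points, so a bi-Lipschitz map to a normed
  space bounds the number of exposed points.

  In detail, let \<open>D\<close> be a bounded Hilbert domain, \<open>c\<close> a point of \<open>D\<close>, and \<open>e\<close>, \<open>f\<close> distinct exposed
  points of its closure.  The points \<open>e\<^sub>\<epsilon> = e - \<epsilon> (e - c)\<close> approach \<open>e\<close> as \<open>\<epsilon>\<close> tends to \<open>0\<close>.  With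
  \<open>T = ln (1 / \<epsilon>)\<close>, the distance from \<open>c\<close> to \<open>e\<^sub>\<epsilon>\<close> is \<open>T / 2 + O(1)\<close>, hence at most \<open>T\<close>, whereas the
  distance from \<open>e\<^sub>\<epsilon>\<close> to \<open>f\<^sub>\<epsilon>\<close> is at least \<open>T / 2 - O(1)\<close>, hence at least \<open>T / 4\<close>, because an affine
  function that exposes \<open>f\<close> is of order \<open>\<epsilon>\<close> at \<open>f\<^sub>\<epsilon>\<close> but of order \<open>1\<close> at \<open>e\<^sub>\<epsilon>\<close>
  (\<open>hilbert_dist_le_near_closure_point\<close>, \<open>hilbert_dist_ge_near_exposed_point\<close>).  After dividing the
  images in the normed space by \<open>T\<close>, any finite set of exposed points becomes a separated set in a
  fixed ball, and packing bounds its size (\<open>finite_exposed_points\<close>).  A compact convex set is the closed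
  convex hull of its exposed points
  (\<open>compact_convex_eq_closure_hull_exposed_points\<close>), so the closure of \<open>D\<close> is a polytope.

  Both distance estimates, and the reduction of an unbounded domain to a bounded one, rest on one
  formula: \<open>boundary_ratio C p q\<close> is the maximum of \<open>g p / g q\<close> over the affine functions \<open>g\<close> that are
  positive on \<open>C\<close> (\<open>boundary_ratio_ge\<close>, \<open>boundary_ratio_attained\<close>).  A projective map turns affine
  functions into affine functions divided by a common denominator, so that it multiplies the two
  ratios of a pair of points by reciprocal factors and preserves the Hilbert distance
  (\<open>hilbert_dist_rescale\<close>).  Since \<open>C\<close> contains no line, its positive affine functions span all affine
  functions; a sum of them dominates the norm on \<open>C\<close>, and dividing by it maps \<open>C\<close> projectively onto a
  bounded domain (\<open>line_free_normalising_functional\<close>).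
\<close>

section \<open>Boundary ratios as maxima over positive affine functions\<close>

text \<open>
  Of two frontier points on the ray from \<open>p\<close> through \<open>q\<close>, the nearer one would lie strictly between the
  interior point \<open>q\<close> and the other one, hence in the interior.  This makes the definite description in
  \<open>boundary_ratio\<close> meaningful.
\<close>

lemma frontier_point_beyond_unique:
  fixes C :: "(real ^ 'n) set"
  assumes C: "open C" "convex C" and q: "q \<in> C"
    and b: "b \<in> frontier C" "q \<in> open_segment p b"
    and b': "b' \<in> frontier C" "q \<in> open_segment p b'"
  shows "b' = b"
proof -
  have key: False
    if "b \<in> frontier C" "b' \<in> frontier C" "0 < s" "s < r" "r < 1"
      "q = (1 - s) *\<^sub>R p + s *\<^sub>R b'" "q = (1 - r) *\<^sub>R p + r *\<^sub>R b" "b \<noteq> q" "b' \<noteq> q"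
    for b b' s r
  proof -
    define u where "u = s * (1 - r) / (r * (1 - s))"
    have u: "0 < u" "u < 1"
      using that by (auto simp: u_def field_simps)
    \<comment> \<open>Both \<open>b\<close> and \<open>b'\<close> lie on the ray from \<open>p\<close>; since \<open>s < r\<close>, the point \<open>b\<close> is the nearer one,
      hence interior.\<close>
    have "(r * (1 - s)) *\<^sub>R b = (r * (1 - s)) *\<^sub>R ((1 - u) *\<^sub>R q + u *\<^sub>R b')"
    proof -
      have 1: "s *\<^sub>R b' = q - (1 - s) *\<^sub>R p"
        using that(6) by simp
      have 2: "r *\<^sub>R b = q - (1 - r) *\<^sub>R p"
        using that(7) by simp
      have ru: "r * (1 - s) * u = s * (1 - r)" "r * (1 - s) * (1 - u) = r - s"
        using that by (simp_all add: u_def field_simps)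
      have "(r * (1 - s)) *\<^sub>R ((1 - u) *\<^sub>R q + u *\<^sub>R b') = (r - s) *\<^sub>R q + (1 - r) *\<^sub>R (s *\<^sub>R b')"
        unfolding scaleR_add_right scaleR_scaleR ru by (simp add: mult.commute)
      also have "\<dots> = (1 - s) *\<^sub>R (r *\<^sub>R b)"
        unfolding 1 2 by (simp add: algebra_simps)
      finally show ?thesis by (metis mult.commute scaleR_scaleR)
    qed
    then have "b = (1 - u) *\<^sub>R q + u *\<^sub>R b'"
      using that by (metis less_numeral_extra(3) mult_pos_pos diff_gt_0_iff_gt less_trans scaleR_left_imp_eq)
    then have "b \<in> open_segment q b'"
      using u that unfolding in_segment by metis
    then have "b \<in> interior C"
      using in_interior_closure_convex_segment[of C q b'] C q that
      by (auto simp: interior_open frontier_def)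
    then show False
      using that by (simp add: frontier_def)
  qed
  obtain r where r: "0 < r" "r < 1" "q = (1 - r) *\<^sub>R p + r *\<^sub>R b"
    using b unfolding in_segment by blast
  obtain s where s: "0 < s" "s < 1" "q = (1 - s) *\<^sub>R p + s *\<^sub>R b'"
    using b' unfolding in_segment by blast
  have ne: "b \<noteq> q" "b' \<noteq> q"
    using b b' by (auto simp: open_segment_def)
  consider "s < r" | "r < s" | "r = s" by linarith
  then show ?thesis
  proof cases
    case 1 then show ?thesis using key[of b b' s r] b b' r s ne by auto
  next
    case 2 then show ?thesis using key[of b' b r s] b b' r s ne by auto
  next
    case 3
    then have "s *\<^sub>R b' = s *\<^sub>R b" using r(3) s(3) by auto
    then show ?thesis using s by auto
  qed
qed

lemma boundary_ratio_cases:
  fixes C :: "(real ^ 'n) set"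
  assumes C: "open C" "convex C" and pq: "p \<in> C" "q \<in> C" "p \<noteq> q"
  obtains (finite) b s where "b \<in> frontier C" "0 < s" "s < 1" "q = (1 - s) *\<^sub>R p + s *\<^sub>R b"
      "boundary_ratio C p q = 1 / (1 - s)"
  | (infinite) "boundary_ratio C p q = 1" "\<And>t. 0 \<le> t \<Longrightarrow> p + t *\<^sub>R (q - p) \<in> C"
proof (cases "\<exists>b\<in>frontier C. q \<in> open_segment p b")
  case True
  then obtain b where b: "b \<in> frontier C" "q \<in> open_segment p b" by blast
  then obtain s where s: "0 < s" "s < 1" "q = (1 - s) *\<^sub>R p + s *\<^sub>R b" and "p \<noteq> b"
    unfolding in_segment by blast
  have "(THE b. b \<in> frontier C \<and> q \<in> open_segment p b) = b"
    using frontier_point_beyond_unique[OF C pq(2) b] b by (intro the_equality) blast+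
  then have "boundary_ratio C p q = norm (p - b) / norm (q - b)"
    using True by (simp add: boundary_ratio_def)
  moreover have "q - b = (1 - s) *\<^sub>R (p - b)"
    unfolding s(3) by (simp add: algebra_simps)
  ultimately have "boundary_ratio C p q = 1 / (1 - s)"
    using s(1,2) \<open>p \<noteq> b\<close> by simp
  then show ?thesis using finite b s by blast
next
  case False
  have "p + t *\<^sub>R (q - p) \<in> C" if "0 \<le> t" for t
  proof (rule ccontr)
    define z where "z = p + t *\<^sub>R (q - p)"
    assume "p + t *\<^sub>R (q - p) \<notin> C"
    then have z: "z \<notin> C" by (simp add: z_def)
    have "1 < t"
    proof (rule ccontr)
      assume "\<not> 1 < t"
      then have "z \<in> closed_segment p q"
        using that unfolding in_segment z_def by (intro exI[of _ t]) (auto simp: algebra_simps)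
      then show False
        using z pq C(2) closed_segment_subset by blast
    qed
    have "closed_segment q z \<inter> frontier C \<noteq> {}"
      using pq z by (intro connected_Int_frontier) auto
    then obtain b where "b \<in> frontier C" "b \<in> closed_segment q z"
      by blast
    then obtain u where b: "b \<in> frontier C" "0 \<le> u" "u \<le> 1" "b = (1 - u) *\<^sub>R q + u *\<^sub>R z"
      unfolding in_segment by blast
    have "b \<noteq> q"
      using b(1) pq C(1) by (auto simp: frontier_def interior_open)
    then have u: "0 < u" using b by (cases "u = 0") auto
    define m where "m = 1 + u * (t - 1)"
    have m: "1 < m" using u \<open>1 < t\<close> by (simp add: m_def)
    have bm: "b = p + m *\<^sub>R (q - p)"
      unfolding b(4) z_def m_def by (simp add: algebra_simps)
    then have "q = (1 - 1 / m) *\<^sub>R p + (1 / m) *\<^sub>R b"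
      unfolding bm using m by (simp add: scaleR_add_right scaleR_diff_left)
    moreover have "p \<noteq> b"
      using bm m pq by simp
    ultimately have "q \<in> open_segment p b"
      unfolding in_segment using m by (intro conjI exI[of _ "1 / m"]) auto
    then show False using False b(1) by blast
  qed
  then show ?thesis using infinite False by (simp add: boundary_ratio_def)
qed

lemma nonneg_on_closure:
  fixes a :: "'a::real_inner"
  assumes "\<And>x. x \<in> C \<Longrightarrow> 0 \<le> a \<bullet> x + \<beta>" "z \<in> closure C"
  shows "0 \<le> a \<bullet> z + \<beta>"
  by (rule continuous_ge_on_closure[of C "\<lambda>x. a \<bullet> x + \<beta>"]) (auto intro!: continuous_intros assms)

text \<open>
  The separating inequality becomes strict because \<open>C\<close> is open.  The constant term is
  \<open>- (a \<bullet> z)\<close>, so that the affine function vanishes at \<open>z\<close>; at a frontier point this is a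
  supporting function.
\<close>

lemma positive_functional_vanishing_at:
  fixes C :: "'a::euclidean_space set"
  assumes "open C" "convex C" "z \<notin> C"
  obtains a where "\<And>x. x \<in> C \<Longrightarrow> 0 < a \<bullet> x + (- (a \<bullet> z))"
proof (cases "C = {}")
  case False
  obtain a b where a: "a \<noteq> 0" "\<And>x. x \<in> C \<Longrightarrow> b \<le> a \<bullet> x" "a \<bullet> z \<le> b"
    using separating_hyperplane_sets[of "{z}" C] assms False by auto
  have "0 < a \<bullet> x - a \<bullet> z" if "x \<in> C" for x
  proof -
    obtain e where e: "0 < e" "cball x e \<subseteq> C"
      using assms(1) \<open>x \<in> C\<close> open_contains_cball by blast
    have "x - (e / norm a) *\<^sub>R a \<in> C"
      using e a(1) by (auto intro!: subsetD[OF e(2)] simp: dist_norm)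
    from a(2)[OF this] have "b + e / norm a * (a \<bullet> a) \<le> a \<bullet> x"
      by (simp add: inner_diff_right)
    moreover have "0 < e / norm a * (a \<bullet> a)"
      using e a(1) by simp
    ultimately show ?thesis using a(3) by linarith
  qed
  then show ?thesis using that[of a] by simp
qed (use that in auto)

text \<open>
  If \<open>q = (1 - s) p + s b\<close> with \<open>b\<close> on the frontier, then \<open>g q \<ge> (1 - s) g p\<close> because \<open>g b \<ge> 0\<close>; and
  \<open>1 / (1 - s)\<close> is the boundary ratio.  If the ray from \<open>p\<close> through \<open>q\<close> stays in \<open>C\<close>, a nonnegative
  affine function cannot decrease along it.
\<close>

lemma boundary_ratio_ge:
  fixes C :: "(real ^ 'n) set"
  assumes C: "open C" "convex C" and pq: "p \<in> C" "q \<in> C" "p \<noteq> q"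
    and g: "\<And>x. x \<in> C \<Longrightarrow> 0 \<le> a \<bullet> x + \<beta>"
  shows "a \<bullet> p + \<beta> \<le> boundary_ratio C p q * (a \<bullet> q + \<beta>)"
  using C pq
proof (cases rule: boundary_ratio_cases)
  case (finite b s)
  have "0 \<le> a \<bullet> b + \<beta>"
    using nonneg_on_closure[OF g] finite(1) by (auto simp: frontier_def)
  moreover have "a \<bullet> q + \<beta> = (1 - s) * (a \<bullet> p + \<beta>) + s * (a \<bullet> b + \<beta>)"
    unfolding finite(4) by (simp add: algebra_simps)
  ultimately have "(1 - s) * (a \<bullet> p + \<beta>) \<le> a \<bullet> q + \<beta>"
    using finite(2) by simp
  then show ?thesis
    unfolding finite(5) using finite(3) by (simp add: pos_le_divide_eq mult.commute)
next
  case infinite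
  have "a \<bullet> p + \<beta> \<le> a \<bullet> q + \<beta>"
  proof (rule ccontr)
    define d where "d = a \<bullet> p - a \<bullet> q"
    assume "\<not> ?thesis"
    then have d: "0 < d" by (simp add: d_def)
    \<comment> \<open>At parameter \<open>t\<close> the affine function would have dropped to \<open>-1\<close>.\<close>
    define t where "t = (a \<bullet> p + \<beta> + 1) / d"
    have "0 \<le> t" using d g[OF pq(1)] by (simp add: t_def)
    from g[OF infinite(2)[OF this]] have "0 \<le> a \<bullet> p + \<beta> - t * d"
      by (simp add: d_def algebra_simps)
    then show False using d by (simp add: t_def)
  qed
  then show ?thesis by (simp add: infinite(1))
qed

text \<open>
  The preceding inequality is an equality for a function supporting \<open>C\<close> at \<open>b\<close>, or for
  the constant \<open>1\<close> if \<open>b\<close> is at infinity.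
\<close>

lemma boundary_ratio_attained:
  fixes C :: "(real ^ 'n) set"
  assumes C: "open C" "convex C" and pq: "p \<in> C" "q \<in> C" "p \<noteq> q"
  obtains a \<beta> where "\<And>x. x \<in> C \<Longrightarrow> 0 < a \<bullet> x + \<beta>"
    "a \<bullet> p + \<beta> = boundary_ratio C p q * (a \<bullet> q + \<beta>)"
  using C pq
proof (cases rule: boundary_ratio_cases)
  case (finite b s)
  have "b \<notin> C" using finite(1) C(1) by (simp add: frontier_def interior_open)
  then obtain a where a: "\<And>x. x \<in> C \<Longrightarrow> 0 < a \<bullet> x + (- (a \<bullet> b))"
    using positive_functional_vanishing_at C by blast
  have "a \<bullet> q + (- (a \<bullet> b)) = (1 - s) * (a \<bullet> p + (- (a \<bullet> b)))"
    unfolding finite(4) by (simp add: algebra_simps)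
  then show ?thesis
    using that[OF a] finite(3,5) by simp
next
  case infinite
  then show ?thesis using that[of 0 1] by simp
qed

lemma boundary_ratio_ge_1:
  fixes C :: "(real ^ 'n) set"
  assumes "open C" "convex C" "p \<in> C" "q \<in> C" "p \<noteq> q"
  shows "1 \<le> boundary_ratio C p q"
  using boundary_ratio_ge[OF assms, of 0 1] by simp

lemma boundary_ratio_le:
  fixes C :: "(real ^ 'n) set"
  assumes C: "open C" "convex C" and pq: "p \<in> C" "q \<in> C" "p \<noteq> q"
    and t: "\<And>a \<beta>. (\<And>x. x \<in> C \<Longrightarrow> 0 < a \<bullet> x + \<beta>) \<Longrightarrow> a \<bullet> p + \<beta> \<le> t * (a \<bullet> q + \<beta>)"
  shows "boundary_ratio C p q \<le> t"
proof -
  obtain a \<beta> where g: "\<And>x. x \<in> C \<Longrightarrow> 0 < a \<bullet> x + \<beta>"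
    "a \<bullet> p + \<beta> = boundary_ratio C p q * (a \<bullet> q + \<beta>)"
    using boundary_ratio_attained[OF C pq] by blast
  have "boundary_ratio C p q * (a \<bullet> q + \<beta>) \<le> t * (a \<bullet> q + \<beta>)"
    using t[OF g(1)] g(2) by simp
  then show ?thesis using g(1)[OF pq(2)] by simp
qed

section \<open>Compact convex sets and their exposed points\<close>

text \<open>
  The hyperplane through \<open>e\<close> orthogonal to \<open>e - c\<close> touches the ball about \<open>c\<close> through \<open>e\<close> only at \<open>e\<close>,
  and that ball contains \<open>K\<close>.
\<close>

lemma farthest_point_is_exposed:
  fixes K :: "'a::euclidean_space set"
  assumes "convex K" "e \<in> K" and far: "\<And>y. y \<in> K \<Longrightarrow> dist c y \<le> dist c e"
  shows "{e} exposed_face_of K"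
proof -
  have lt: "(e - c) \<bullet> y < (e - c) \<bullet> e" if "y \<in> K" "y \<noteq> e" for y
  proof -
    have "(norm (y - c))\<^sup>2 \<le> (norm (e - c))\<^sup>2"
      using far[OF that(1)] by (simp add: dist_norm norm_minus_commute)
    moreover have "(norm (y - c))\<^sup>2 = (norm (e - c))\<^sup>2 - 2 * ((e - c) \<bullet> (e - y)) + (norm (e - y))\<^sup>2"
      by (simp add: power2_norm_eq_inner algebra_simps inner_commute)
    moreover have "0 < (norm (e - y))\<^sup>2" using that by simp
    ultimately have "0 < 2 * ((e - c) \<bullet> (e - y))" by linarith
    then show ?thesis by (simp add: inner_diff_right)
  qed
  have "K \<inter> {x. (e - c) \<bullet> x = (e - c) \<bullet> e} = {e}"
    using assms(2) lt by fastforce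
  moreover have "(K \<inter> {x. (e - c) \<bullet> x = (e - c) \<bullet> e}) exposed_face_of K"
    using assms(1) lt by (intro exposed_face_of_Int_supporting_hyperplane_le) force+
  ultimately show ?thesis by simp
qed

text \<open>
  A point \<open>x\<close> of \<open>K\<close> outside the closed hull of the exposed points could be separated from this hull not
  only by a hyperplane but also by a sufficiently large ball.  The point of \<open>K\<close> farthest from the centre
  of the ball is then exposed, but lies outside the ball, and so outside the hull.
\<close>

proposition compact_convex_eq_closure_hull_exposed_points:
  fixes K :: "'a::euclidean_space set"
  assumes K: "compact K" "convex K"
  shows "K = closure (convex hull {e. {e} exposed_face_of K})" (is "K = ?H")
proof
  have "{e. {e} exposed_face_of K} \<subseteq> K"
    by (auto simp: exposed_face_of_def dest: face_of_imp_subset)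
  then have "convex hull {e. {e} exposed_face_of K} \<subseteq> K"
    using K(2) by (rule hull_minimal)
  then show KH: "?H \<subseteq> K"
    using K(1) by (simp add: closure_minimal compact_imp_closed)
  show "K \<subseteq> ?H"
  proof (rule ccontr)
    assume "\<not> K \<subseteq> ?H"
    then obtain x where x: "x \<in> K" "x \<notin> ?H" by blast
    obtain a b where ab: "a \<bullet> x < b" "\<And>y. y \<in> ?H \<Longrightarrow> b < a \<bullet> y"
      using separating_hyperplane_closed_point[of ?H x] x(2) by (auto simp: convex_closure)
    obtain M where M: "\<And>y. y \<in> K \<Longrightarrow> norm (y - x) \<le> M"
    proof -
      obtain r where "\<And>y. y \<in> K \<Longrightarrow> norm y \<le> r"
        using compact_imp_bounded[OF K(1)] by (auto simp: bounded_iff)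
      then have "norm (y - x) \<le> r + norm x" if "y \<in> K" for y
        using that norm_triangle_ineq4[of y x] by fastforce
      then show ?thesis using that by blast
    qed
    define d where "d = b - a \<bullet> x"
    have d: "0 < d" using ab(1) by (simp add: d_def)
    \<comment> \<open>With this \<open>t\<close>, the ball about \<open>x + t a\<close> through \<open>x\<close> contains the hull in its interior: moving the
      centre by \<open>t a\<close> changes the difference of squared distances to \<open>y\<close> and \<open>x\<close> by
      \<open>- 2 t a \<bullet> (y - x) \<le> - 2 t d\<close>, and \<open>2 t d\<close> exceeds \<open>M\<^sup>2 \<ge> |y - x|\<^sup>2\<close>.\<close>
    define t where "t = (M\<^sup>2 + 1) / (2 * d)"
    define c where "c = x + t *\<^sub>R a"
    have t: "0 < t" "2 * t * d = M\<^sup>2 + 1"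
      using d by (simp_all add: t_def add_nonneg_pos)
    have near: "dist c y < dist c x" if y: "y \<in> ?H" for y
    proof -
      have "(norm (y - x))\<^sup>2 \<le> M\<^sup>2"
        using M[of y] y KH by (intro power_mono) auto
      moreover have "2 * t * d \<le> 2 * t * (a \<bullet> (y - x))"
        using t(1) ab(2)[OF y] by (intro mult_left_mono) (auto simp: d_def inner_diff_right)
      moreover have "(dist c y)\<^sup>2 = (norm (y - x))\<^sup>2 - 2 * t * (a \<bullet> (y - x)) + (dist c x)\<^sup>2"
        by (simp add: dist_norm c_def power2_norm_eq_inner algebra_simps inner_commute)
          (simp add: power2_eq_square)
      ultimately have "(dist c y)\<^sup>2 < (dist c x)\<^sup>2" using t(2) by linarith
      then show ?thesis by (rule power2_less_imp_less) simp
    qed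
    obtain e where e: "e \<in> K" "\<And>y. y \<in> K \<Longrightarrow> dist c y \<le> dist c e"
      using distance_attains_sup[OF K(1), of c] x(1) by blast
    have "{e} exposed_face_of K"
      by (rule farthest_point_is_exposed[OF K(2) e])
    then have "e \<in> convex hull {e. {e} exposed_face_of K}"
      by (simp add: hull_inc)
    then have "e \<in> ?H" using closure_subset by blast
    then show False using near e(2)[OF x(1)] by fastforce
  qed
qed

section \<open>Packing in finite-dimensional normed spaces\<close>

text \<open>
  An infinite basis has cardinality \<open>0\<close>, so the assumption includes that the dimension is finite.
\<close>

lemma linear_iso_of_dim:
  assumes "dim (UNIV :: 'v::real_normed_vector set) = CARD('n::finite)"
  obtains f :: "real ^ 'n \<Rightarrow> 'v::real_normed_vector" where "linear f" "bij f"
proof -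
  obtain B :: "'v set" where B: "independent B" "UNIV \<subseteq> span B" "card B = CARD('n)"
    using basis_exists[of "UNIV :: 'v set"] assms by metis
  have fin: "finite B" using B(3) by (metis card.infinite card_0_eq finite UNIV_not_empty)
  then obtain b where b: "bij_betw b (UNIV :: 'n set) B"
    using B(3) by (metis finite finite_same_card_bij)
  define f :: "real ^ 'n \<Rightarrow> 'v" where "f x = (\<Sum>i\<in>UNIV. x $ i *\<^sub>R b i)" for x
  have lin: "linear f"
    by (rule linearI) (simp_all add: f_def scaleR_add_left sum.distrib scaleR_sum_right)
  have f_eq: "f x = (\<Sum>v\<in>B. x $ inv_into UNIV b v *\<^sub>R v)" for x
    unfolding f_def using b
    by (subst sum.reindex_bij_betw[OF b, symmetric]) (auto simp: bij_betw_def inj_on_def)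
  have "x = 0" if "f x = 0" for x
  proof -
    have "x $ inv_into UNIV b v = 0" if "v \<in> B" for v
      using \<open>f x = 0\<close> that unfolding f_eq
      by (rule independentD[OF B(1) fin order.refl, where u = "\<lambda>v. x $ inv_into UNIV b v"])
    then have "x $ i = 0" for i
      using b by (metis UNIV_I bij_betwE bij_betw_inv_into_left)
    then show ?thesis by (simp add: vec_eq_iff)
  qed
  then have "inj f" using lin by (simp add: linear_injective_0)
  moreover have "surj f"
  proof -
    have "b i \<in> range f" for i
    proof
      show "b i = f (axis i 1)"
        by (simp add: f_def axis_def if_distrib[of "\<lambda>r. r *\<^sub>R _"] cong: if_cong)
    qed simp
    then have "B \<subseteq> range f" using b by (auto simp: bij_betw_def)
    then have "span B \<subseteq> range f"
      by (rule span_minimal) (simp add: lin linear_subspace_image subspace_UNIV)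
    then show ?thesis using B(2) by blast
  qed
  ultimately show ?thesis using that lin by (simp add: bij_def)
qed

text \<open>
  The linear isomorphism with Euclidean space is bounded below, by its minimum on the unit sphere; so
  the ball is the image of a closed bounded set.
\<close>

lemma compact_cball_finite_dim:
  assumes "dim (UNIV :: 'v::real_normed_vector set) = CARD('n::finite)"
  shows "compact (cball (0::'v) r)"
proof -
  obtain f :: "real ^ 'n \<Rightarrow> 'v" where f: "linear f" "bij f"
    using linear_iso_of_dim[OF assms] by blast
  have cont: "continuous_on S f" for S
    using f(1) by (simp add: linear_conv_bounded_linear linear_continuous_on)
  obtain m where m: "0 < m" "\<And>x. m * norm x \<le> norm (f x)"
  proof -
    obtain x0 where x0: "x0 \<in> sphere 0 1" "\<And>x. x \<in> sphere 0 1 \<Longrightarrow> norm (f x0) \<le> norm (f x)"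
      using continuous_attains_inf[of "sphere 0 1", OF compact_sphere _ continuous_on_norm[OF cont]]
      by auto
    have "f x0 \<noteq> 0"
      using x0(1) f linear_injective_0[of f] by (auto simp: bij_def)
    moreover have "norm (f x0) * norm x \<le> norm (f x)" for x
    proof (cases "x = 0")
      case False
      then have "norm (f x0) \<le> norm (f ((1 / norm x) *\<^sub>R x))" by (intro x0(2)) simp
      also have "\<dots> = norm (f x) / norm x"
        by (simp add: linear_scale[OF f(1)] divide_inverse mult.commute)
      finally show ?thesis using False by (simp add: field_simps)
    qed simp
    ultimately show ?thesis using that[of "norm (f x0)"] by simp
  qed
  have "bounded (f -` cball 0 r)"
  proof (rule boundedI)
    fix x assume "x \<in> f -` cball 0 r"
    then have "m * norm x \<le> r" using m(2)[of x] by simp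
    then show "norm x \<le> r / m" using m(1) by (simp add: field_simps)
  qed
  moreover have "closed (f -` cball 0 r)"
    using f(1) by (auto intro!: continuous_closed_vimage simp: linear_conv_bounded_linear linear_continuous_at)
  ultimately have "compact (f ` (f -` cball 0 r))"
    by (intro compact_continuous_image cont) (simp add: compact_eq_bounded_closed)
  moreover have "f ` (f -` cball 0 r) = cball 0 r"
    using f(2) by (simp add: bij_def surj_image_vimage_eq)
  ultimately show ?thesis by simp
qed

text \<open>
  Cover \<open>K\<close> by finitely many balls of radius \<open>\<delta> / 2\<close>; no two points of a \<open>\<delta>\<close>-separated family lie in
  the same ball.
\<close>

lemma compact_separated_card_bound:
  fixes K :: "'a::metric_space set"
  assumes "compact K" "0 < \<delta>"
  obtains N where "\<And>S (z :: 'i \<Rightarrow> 'a). (\<And>i. i \<in> S \<Longrightarrow> z i \<in> K) \<Longrightarrow>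
     (\<And>i j. i \<in> S \<Longrightarrow> j \<in> S \<Longrightarrow> i \<noteq> j \<Longrightarrow> \<delta> \<le> dist (z i) (z j)) \<Longrightarrow> card S \<le> N"
proof -
  obtain k where k: "finite k" "K \<subseteq> (\<Union>x\<in>k. ball x (\<delta> / 2))"
    using assms unfolding compact_eq_totally_bounded by (meson half_gt_zero)
  have "card S \<le> card k"
    if S: "\<And>i. i \<in> S \<Longrightarrow> z i \<in> K"
      "\<And>i j. i \<in> S \<Longrightarrow> j \<in> S \<Longrightarrow> i \<noteq> j \<Longrightarrow> \<delta> \<le> dist (z i) (z j)"
    for S and z :: "'i \<Rightarrow> 'a"
  proof -
    have "\<forall>i\<in>S. \<exists>c\<in>k. dist c (z i) < \<delta> / 2" using S(1) k(2) by force
    then obtain c where c: "\<And>i. i \<in> S \<Longrightarrow> c i \<in> k" "\<And>i. i \<in> S \<Longrightarrow> dist (c i) (z i) < \<delta> / 2"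
      by metis
    have "inj_on c S"
    proof (rule inj_onI, rule ccontr)
      fix i j assume ij: "i \<in> S" "j \<in> S" "c i = c j" "i \<noteq> j"
      have "dist (z i) (z j) < \<delta>"
        using c(2)[OF ij(1)] c(2)[OF ij(2)] dist_triangle3[of "z i" "z j" "c i"] ij(3) by simp
      then show False using S(2)[OF ij(1,2,4)] by simp
    qed
    then show ?thesis using c(1) k(1) by (meson card_inj_on_le image_subsetI)
  qed
  then show ?thesis using that by blast
qed

section \<open>Hilbert distances near exposed points\<close>

text \<open>
  A nonnegative affine function is at least \<open>\<epsilon>\<close> times its value at \<open>c\<close> on the point
  \<open>e - \<epsilon> (e - c)\<close>, so one of the two ratios is at most \<open>1 / \<epsilon>\<close>.  The other one stays bounded as
  \<open>\<epsilon>\<close> tends to \<open>0\<close>, since the segment from \<open>e\<close> to \<open>c\<close> can be prolonged inside \<open>D\<close>; so it is eventually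
  below \<open>1 / \<epsilon>\<close> as well.
\<close>

lemma hilbert_dist_le_near_closure_point:
  fixes D :: "(real ^ 'n) set"
  assumes D: "open D" "convex D" and c: "c \<in> D" and e: "e \<in> closure D" "e \<noteq> c"
  shows "\<forall>\<^sub>F \<epsilon> in at_right 0. hilbert_dist D c (e - \<epsilon> *\<^sub>R (e - c)) \<le> ln (1 / \<epsilon>)"
proof -
  obtain r where r: "0 < r" "cball c r \<subseteq> D"
    using D(1) c open_contains_cball by blast
  define \<mu> where "\<mu> = r / norm (e - c)"
  have \<mu>: "0 < \<mu>" using r e by (simp add: \<mu>_def)
  have opp: "c - \<mu> *\<^sub>R (e - c) \<in> D"
    using r e by (intro subsetD[OF r(2)]) (simp add: \<mu>_def dist_norm)
  define A where "A = 1 + 1 / \<mu>"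
  have A: "1 < A" using \<mu> by (simp add: A_def)
  have "hilbert_dist D c x \<le> ln (1 / \<epsilon>)"
    if \<epsilon>: "\<epsilon> \<in> {0<..<1 / A}" and x_def: "x = e - \<epsilon> *\<^sub>R (e - c)" for \<epsilon> x
  proof -
    have "1 / A < 1" using A by simp
    then have \<epsilon>1: "0 < \<epsilon>" "\<epsilon> < 1" using \<epsilon> by auto
    have A\<epsilon>: "A \<le> 1 / \<epsilon>" using \<epsilon> A by (simp add: field_simps)
    have xD: "x \<in> D"
      using mem_interior_closure_convex_shrink[OF D(2) _ e(1), of c \<epsilon>] D(1) c \<epsilon>1
      by (simp add: x_def interior_open)
    have "x - c = (1 - \<epsilon>) *\<^sub>R (e - c)"
      by (simp add: x_def algebra_simps)
    then have ne: "c \<noteq> x" using e(2) \<epsilon>1 by auto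
    have gx: "a \<bullet> x + \<beta> = (1 - \<epsilon>) * (a \<bullet> e + \<beta>) + \<epsilon> * (a \<bullet> c + \<beta>)" for a \<beta>
      by (simp add: x_def algebra_simps)
    have 1: "boundary_ratio D c x \<le> 1 / \<epsilon>"
    proof (rule boundary_ratio_le[OF D c xD ne])
      fix a \<beta> assume g: "\<And>x. x \<in> D \<Longrightarrow> 0 < a \<bullet> x + \<beta>"
      have "0 \<le> a \<bullet> e + \<beta>"
        using nonneg_on_closure[OF _ e(1)] g less_imp_le by blast
      then have "\<epsilon> * (a \<bullet> c + \<beta>) \<le> a \<bullet> x + \<beta>"
        using \<epsilon>1 unfolding gx by simp
      then show "a \<bullet> c + \<beta> \<le> 1 / \<epsilon> * (a \<bullet> x + \<beta>)"
        using \<epsilon>1 by (simp add: pos_le_divide_eq mult.commute)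
    qed
    have "boundary_ratio D x c \<le> A"
    proof (rule boundary_ratio_le[OF D xD c ne[symmetric]])
      fix a \<beta> assume g: "\<And>x. x \<in> D \<Longrightarrow> 0 < a \<bullet> x + \<beta>"
      have "0 < (1 + \<mu>) * (a \<bullet> c + \<beta>) - \<mu> * (a \<bullet> e + \<beta>)"
        using g[OF opp] by (simp add: algebra_simps)
      then have "a \<bullet> e + \<beta> \<le> (1 + \<mu>) * (a \<bullet> c + \<beta>) / \<mu>"
        using \<mu> by (simp add: pos_le_divide_eq mult.commute)
      also have "\<dots> = A * (a \<bullet> c + \<beta>)"
        using \<mu> by (simp add: A_def add_divide_distrib algebra_simps)
      finally have "(1 - \<epsilon>) * (a \<bullet> e + \<beta>) \<le> (1 - \<epsilon>) * (A * (a \<bullet> c + \<beta>))"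
        using \<epsilon>1 by simp
      moreover have "\<epsilon> * (a \<bullet> c + \<beta>) \<le> \<epsilon> * (A * (a \<bullet> c + \<beta>))"
        using \<epsilon>1 A g[OF c] by simp
      ultimately show "a \<bullet> x + \<beta> \<le> A * (a \<bullet> c + \<beta>)"
        unfolding gx by (simp add: algebra_simps)
    qed
    with A\<epsilon> have 2: "boundary_ratio D x c \<le> 1 / \<epsilon>" by linarith
    have pos: "1 \<le> boundary_ratio D x c" "1 \<le> boundary_ratio D c x"
      using boundary_ratio_ge_1[OF D] xD c ne by auto
    have "boundary_ratio D x c * boundary_ratio D c x \<le> 1 / \<epsilon> * (1 / \<epsilon>)"
      using 1 2 pos \<epsilon>1 by (intro mult_mono) auto
    then have "ln (boundary_ratio D x c * boundary_ratio D c x) \<le> ln (1 / \<epsilon> * (1 / \<epsilon>))"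
      using pos by (intro ln_mono) (auto intro!: mult_pos_pos)
    also have "\<dots> = 2 * ln (1 / \<epsilon>)"
      using \<epsilon>1 ln_mult_pos[of "1 / \<epsilon>" "1 / \<epsilon>"] by simp
    finally show ?thesis
      using ne by (simp add: hilbert_dist_def)
  qed
  moreover have "\<forall>\<^sub>F \<epsilon> in at_right 0. \<epsilon> \<in> {0<..<1 / A}"
    using A by (intro eventually_at_right_real) simp
  ultimately show ?thesis
    by (auto elim: eventually_mono)
qed

text \<open>
  Let \<open>g\<close> be an affine function that vanishes at \<open>f\<close> and is positive on the rest of the closure.  The
  ratio of its values at \<open>e - \<epsilon> (e - c)\<close> and \<open>f - \<epsilon> (f - c)\<close> is of order \<open>1 / \<epsilon>\<close>, which bounds one
  boundary ratio from below; the other one is at least \<open>1\<close>.  Exposedness of \<open>f\<close> is essential: at a point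
  that is only extreme, every supporting affine function may vanish at \<open>e\<close> too.
\<close>

lemma hilbert_dist_ge_near_exposed_point:
  fixes D :: "(real ^ 'n) set"
  assumes D: "open D" "convex D" and c: "c \<in> D" and e: "e \<in> closure D" "e \<noteq> f"
    and f: "{f} exposed_face_of closure D" "f \<noteq> c"
  shows "\<forall>\<^sub>F \<epsilon> in at_right 0.
    ln (1 / \<epsilon>) / 4 \<le> hilbert_dist D (e - \<epsilon> *\<^sub>R (e - c)) (f - \<epsilon> *\<^sub>R (f - c))"
proof -
  obtain a' \<beta> where ab: "closure D \<subseteq> {x. a' \<bullet> x \<le> \<beta>}" "{f} = closure D \<inter> {x. a' \<bullet> x = \<beta>}"
    using f(1) unfolding exposed_face_of_def by blast
  define a where "a = - a'"
  have g0: "a \<bullet> f + \<beta> = 0" "f \<in> closure D" using ab(2) by (auto simp: a_def)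
  have g: "0 \<le> a \<bullet> x + \<beta>" if "x \<in> closure D" for x
    using ab(1) that by (auto simp: a_def)
  have gpos: "0 < a \<bullet> x + \<beta>" if "x \<in> closure D" "x \<noteq> f" for x
  proof -
    have "a' \<bullet> x \<noteq> \<beta>" using ab(2) that by blast
    then show ?thesis using ab(1) that by (fastforce simp: a_def)
  qed
  have cl: "c \<in> closure D" using c closure_subset by blast
  have go: "0 < a \<bullet> c + \<beta>" using gpos[OF cl] f(2) by blast
  have ge: "0 < a \<bullet> e + \<beta>" using gpos e by blast
  define \<kappa> where "\<kappa> = (a \<bullet> e + \<beta>) / (a \<bullet> c + \<beta>)"
  have \<kappa>: "0 < \<kappa>" "a \<bullet> e + \<beta> = \<kappa> * (a \<bullet> c + \<beta>)" using go ge by (auto simp: \<kappa>_def)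
  have "ln (1 / \<epsilon>) / 4 \<le> hilbert_dist D x y"
    if \<epsilon>: "\<epsilon> \<in> {0<..<min (1/2) (\<kappa>\<^sup>2 / 4)}"
      and x_def: "x = e - \<epsilon> *\<^sub>R (e - c)" and y_def: "y = f - \<epsilon> *\<^sub>R (f - c)" for \<epsilon> x y
  proof -
    have \<epsilon>1: "0 < \<epsilon>" "\<epsilon> < 1/2" "\<epsilon> < \<kappa>\<^sup>2 / 4" using \<epsilon> by auto
    have xD: "x \<in> D"
      using mem_interior_closure_convex_shrink[OF D(2) _ e(1), of c \<epsilon>] D(1) c \<epsilon>1
      by (simp add: x_def interior_open)
    have yD: "y \<in> D"
      using mem_interior_closure_convex_shrink[OF D(2) _ g0(2), of c \<epsilon>] D(1) c \<epsilon>1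
      by (simp add: y_def interior_open)
    have "x - y = (1 - \<epsilon>) *\<^sub>R (e - f)"
      by (simp add: x_def y_def algebra_simps)
    then have ne: "x \<noteq> y" using e(2) \<epsilon>1 by auto
    define R where "R = boundary_ratio D x y"
    have "a \<bullet> y + \<beta> = (1 - \<epsilon>) * (a \<bullet> f + \<beta>) + \<epsilon> * (a \<bullet> c + \<beta>)"
      by (simp add: y_def algebra_simps)
    then have gy: "a \<bullet> y + \<beta> = \<epsilon> * (a \<bullet> c + \<beta>)" using g0(1) by simp
    have "a \<bullet> x + \<beta> = (1 - \<epsilon>) * (a \<bullet> e + \<beta>) + \<epsilon> * (a \<bullet> c + \<beta>)"
      by (simp add: x_def algebra_simps)
    moreover have "1/2 * (a \<bullet> e + \<beta>) \<le> (1 - \<epsilon>) * (a \<bullet> e + \<beta>)"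
      using \<epsilon>1 ge by (intro mult_right_mono) auto
    moreover have "0 < \<epsilon> * (a \<bullet> c + \<beta>)" using \<epsilon>1 go by simp
    ultimately have "1/2 * (a \<bullet> e + \<beta>) \<le> a \<bullet> x + \<beta>" by linarith
    also have "\<dots> \<le> R * (a \<bullet> y + \<beta>)"
      unfolding R_def using g closure_subset[of D] by (intro boundary_ratio_ge[OF D xD yD ne]) auto
    finally have "\<kappa> / 2 * (a \<bullet> c + \<beta>) \<le> R * \<epsilon> * (a \<bullet> c + \<beta>)"
      unfolding gy \<kappa>(2) by simp
    then have R: "\<kappa> / 2 \<le> R * \<epsilon>" using go by simp
    have R1: "1 \<le> R" unfolding R_def using boundary_ratio_ge_1[OF D xD yD ne] .
    have R2: "1 \<le> boundary_ratio D y x" using boundary_ratio_ge_1[OF D yD xD] ne by auto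
    have "\<epsilon> \<le> (\<kappa> / 2)\<^sup>2" using \<epsilon>1 by (simp add: power_divide)
    also have "\<dots> \<le> (R * \<epsilon>)\<^sup>2" using R \<kappa> by (intro power_mono) auto
    finally have "1 / \<epsilon> \<le> R\<^sup>2"
      using \<epsilon>1 by (simp add: field_simps power2_eq_square)
    then have "ln (1 / \<epsilon>) \<le> ln (R\<^sup>2)" using \<epsilon>1 by (intro ln_mono) auto
    also have "\<dots> = 2 * ln R" using R1 by (simp add: ln_realpow)
    also have "\<dots> \<le> 2 * ln (boundary_ratio D y x * R)"
      using R1 R2 by (auto intro!: ln_mono simp: mult_le_cancel_right1)
    finally show ?thesis
      using ne by (simp add: hilbert_dist_def R_def)
  qed
  moreover have "\<forall>\<^sub>F \<epsilon> in at_right 0. \<epsilon> \<in> {0<..<min (1/2) (\<kappa>\<^sup>2 / 4)}"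
    using \<kappa>(1) by (intro eventually_at_right_real) simp
  ultimately show ?thesis
    by (auto elim: eventually_mono)
qed

text \<open>
  Only the images of finitely many points at scale \<open>T = ln (1 / \<epsilon>)\<close> enter, so that a bound on the
  number of separated points in one compact ball suffices.
\<close>

proposition finite_exposed_points:
  fixes D :: "(real ^ 'n) set" and \<phi> :: "real ^ 'n \<Rightarrow> 'v::real_normed_vector"
  assumes D: "open D" "convex D" "D \<noteq> {}" and L: "0 < L" and K: "compact (cball (0::'v) L)"
    and upper: "\<And>p q. p \<in> D \<Longrightarrow> q \<in> D \<Longrightarrow> norm (\<phi> p - \<phi> q) \<le> L * hilbert_dist D p q"
    and lower: "\<And>p q. p \<in> D \<Longrightarrow> q \<in> D \<Longrightarrow> hilbert_dist D p q \<le> L * norm (\<phi> p - \<phi> q)"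
  shows "finite {e. {e} exposed_face_of closure D}"
proof -
  have "0 < 1 / (4 * L)" using L by simp
  then obtain N where N: "\<And>S (z :: real ^ 'n \<Rightarrow> 'v). (\<And>i. i \<in> S \<Longrightarrow> z i \<in> cball 0 L) \<Longrightarrow>
     (\<And>i j. i \<in> S \<Longrightarrow> j \<in> S \<Longrightarrow> i \<noteq> j \<Longrightarrow> 1 / (4 * L) \<le> dist (z i) (z j)) \<Longrightarrow> card S \<le> N"
    by (rule compact_separated_card_bound[OF K]) blast
  have "card S \<le> N" if S: "S \<subseteq> {e. {e} exposed_face_of closure D}" "finite S" for S
  proof -
    \<comment> \<open>A centre outside \<open>S\<close> is distinct from every \<open>e\<close> in \<open>S\<close>, so that all the segments from \<open>c\<close> are
      nondegenerate.\<close>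
    have "\<not> D \<subseteq> S" using finite_imp_not_open[of D] D S(2) finite_subset by blast
    then obtain c where c: "c \<in> D" "c \<notin> S" by blast
    define x where "x \<epsilon> e = e - \<epsilon> *\<^sub>R (e - c)" for \<epsilon> e
    have cl: "e \<in> closure D" if "e \<in> S" for e
      using S(1) that by (auto simp: exposed_face_of_def dest: face_of_imp_subset)
    have "\<forall>\<^sub>F \<epsilon> in at_right 0. \<forall>e\<in>S. hilbert_dist D c (x \<epsilon> e) \<le> ln (1 / \<epsilon>)"
      using cl c unfolding x_def
      by (intro eventually_ball_finite S(2) ballI hilbert_dist_le_near_closure_point D) auto
    moreover have "\<forall>\<^sub>F \<epsilon> in at_right 0. \<forall>e\<in>S. \<forall>f\<in>S - {e}.
        ln (1 / \<epsilon>) / 4 \<le> hilbert_dist D (x \<epsilon> e) (x \<epsilon> f)"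
      using cl c S unfolding x_def
      by (intro eventually_ball_finite S(2) finite_Diff ballI hilbert_dist_ge_near_exposed_point D) auto
    moreover have "\<forall>\<^sub>F \<epsilon> in at_right 0. \<epsilon> \<in> {0<..<1::real}"
      by (intro eventually_at_right_real) simp
    ultimately have "\<forall>\<^sub>F \<epsilon> in at_right 0. \<epsilon> \<in> {0<..<1::real} \<and>
       (\<forall>e\<in>S. hilbert_dist D c (x \<epsilon> e) \<le> ln (1 / \<epsilon>)) \<and>
       (\<forall>e\<in>S. \<forall>f\<in>S - {e}. ln (1 / \<epsilon>) / 4 \<le> hilbert_dist D (x \<epsilon> e) (x \<epsilon> f))"
      by eventually_elim blast
    from eventually_happens'[OF trivial_limit_at_right_real this] obtain \<epsilon> where \<epsilon>: "0 < \<epsilon>" "\<epsilon> < 1"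
      and near: "\<And>e. e \<in> S \<Longrightarrow> hilbert_dist D c (x \<epsilon> e) \<le> ln (1 / \<epsilon>)"
      and far: "\<And>e f. e \<in> S \<Longrightarrow> f \<in> S \<Longrightarrow> e \<noteq> f \<Longrightarrow>
        ln (1 / \<epsilon>) / 4 \<le> hilbert_dist D (x \<epsilon> e) (x \<epsilon> f)"
      by (elim exE conjE) auto
    define T where "T = ln (1 / \<epsilon>)"
    have T: "0 < T" using \<epsilon> by (simp add: T_def)
    have xD: "x \<epsilon> e \<in> D" if "e \<in> S" for e
      using mem_interior_closure_convex_shrink[OF D(2) _ cl[OF that], of c \<epsilon>] D(1) c \<epsilon>
      by (simp add: x_def interior_open)
    define z where "z e = (1 / T) *\<^sub>R (\<phi> (x \<epsilon> e) - \<phi> c)" for e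
    show ?thesis
    proof (rule N)
      fix e assume e: "e \<in> S"
      have "norm (\<phi> c - \<phi> (x \<epsilon> e)) \<le> L * hilbert_dist D c (x \<epsilon> e)"
        using upper c(1) xD[OF e] by blast
      also have "\<dots> \<le> L * T"
        using near[OF e] L by (simp add: T_def)
      finally show "z e \<in> cball 0 L"
        using T by (simp add: z_def norm_minus_commute pos_divide_le_eq)
    next
      fix e f assume ef: "e \<in> S" "f \<in> S" "e \<noteq> f"
      have "T / 4 \<le> L * norm (\<phi> (x \<epsilon> e) - \<phi> (x \<epsilon> f))"
        using far[OF ef] lower[OF xD[OF ef(1)] xD[OF ef(2)]] by (simp add: T_def)
      moreover have "norm (\<phi> (x \<epsilon> e) - \<phi> (x \<epsilon> f)) = T * dist (z e) (z f)"
        using T by (simp add: z_def dist_norm flip: scaleR_diff_right)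
      ultimately have "T * 1 \<le> T * (4 * L * dist (z e) (z f))"
        by (simp add: mult_ac)
      then have "1 \<le> 4 * L * dist (z e) (z f)"
        using T by (simp only: mult_le_cancel_left_pos)
      then show "1 / (4 * L) \<le> dist (z e) (z f)"
        using L by (simp add: field_simps)
    qed
  qed
  then show ?thesis
    using finite_if_finite_subsets_card_bdd by blast
qed

section \<open>Projective maps to bounded domains\<close>

text \<open>
  Affine functions are identified with vectors \<open>w\<close> of the homogeneous coordinate space, \<open>w \<bullet> (x, 1)\<close>
  being the value at \<open>x\<close>.  A vector orthogonal to all functions that are nonnegative on \<open>C\<close> has last
  coordinate \<open>0\<close>, because the constant \<open>1\<close> is among them; its other coordinates form a direction along
  which all these functions are constant, and by separation every line in this direction that meets \<open>C\<close>
  is contained in \<open>C\<close>.  So the nonnegative functions contain a basis of the space of all affine functions, and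
  the sum of this basis dominates every affine function on \<open>C\<close>, in particular the coordinates.
\<close>

lemma line_free_normalising_functional:
  fixes C :: "(real ^ 'n) set"
  assumes "hilbert_domain C"
  obtains c \<beta> A where "0 < \<beta>" "\<And>x. x \<in> C \<Longrightarrow> 0 < c \<bullet> x + \<beta>"
    "\<And>x. x \<in> C \<Longrightarrow> norm x \<le> A * (c \<bullet> x + \<beta>)"
proof -
  have C: "C \<noteq> {}" "open C" "convex C" and noline: "\<And>x y. x \<noteq> y \<Longrightarrow> \<not> affine hull {x, y} \<subseteq> C"
    using assms unfolding hilbert_domain_def by blast+
  define G where "G = {w :: (real ^ 'n) \<times> real. \<forall>x\<in>C. 0 \<le> w \<bullet> (x, 1)}"
  have "span G = UNIV"
  proof (rule ccontr)
    assume "span G \<noteq> UNIV"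
    then obtain w where w: "w \<noteq> 0" "\<And>g. g \<in> G \<Longrightarrow> w \<bullet> g = 0"
      using span_not_UNIV_orthogonal span_base by metis
    obtain v s where vs: "w = (v, s)" by fastforce
    have "(0, 1) \<in> G" by (simp add: G_def inner_Pair)
    from w(2)[OF this] have s: "s = 0" by (simp add: vs inner_Pair)
    then have v: "v \<noteq> 0" using w(1) vs by (simp add: zero_prod_def)
    obtain x0 where x0: "x0 \<in> C" using C(1) by blast
    have line: "x0 + t *\<^sub>R v \<in> C" for t
    proof (rule ccontr)
      assume "x0 + t *\<^sub>R v \<notin> C"
      then obtain a where a: "\<And>x. x \<in> C \<Longrightarrow> 0 < a \<bullet> x + (- (a \<bullet> (x0 + t *\<^sub>R v)))"
        using positive_functional_vanishing_at C by blast
      then have "(a, - (a \<bullet> (x0 + t *\<^sub>R v))) \<in> G"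
        by (auto simp: G_def inner_Pair less_imp_le)
      from w(2)[OF this] have "a \<bullet> v = 0"
        by (simp add: vs s inner_Pair inner_commute)
      then show False using a[OF x0] by (simp add: inner_add_right)
    qed
    have "affine hull {x0, x0 + v} \<subseteq> C"
    proof
      fix y assume "y \<in> affine hull {x0, x0 + v}"
      then obtain u r where "y = u *\<^sub>R x0 + r *\<^sub>R (x0 + v)" "u + r = 1"
        by (auto simp: affine_hull_2)
      then have "y = x0 + r *\<^sub>R v"
        by (simp add: algebra_simps flip: scaleR_add_left)
      then show "y \<in> C" using line by simp
    qed
    then show False using noline[of x0 "x0 + v"] v by simp
  qed
  moreover obtain B where B: "B \<subseteq> G" "independent B" "G \<subseteq> span B"
    using maximal_independent_subset by blast
  ultimately have spanB: "span B = UNIV"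
    by (metis span_minimal subspace_span top.extremum_uniqueI)
  have fin: "finite B" using B(2) by (rule independent_imp_finite)
  define h0 where "h0 x = (\<Sum>g\<in>B. g \<bullet> (x, 1::real))" for x :: "real ^ 'n"
  have B0: "0 \<le> g \<bullet> (x, 1)" if "g \<in> B" "x \<in> C" for g x
    using that B(1) by (auto simp: G_def)
  have dom: "\<exists>A. \<forall>x\<in>C. \<bar>w \<bullet> (x, 1)\<bar> \<le> A * h0 x" for w :: "(real ^ 'n) \<times> real"
  proof -
    have "w \<in> span B" by (simp add: spanB)
    then show ?thesis
    proof (induction rule: span_induct_alt)
      case base
      then show ?case by (intro exI[of _ 0]) simp
    next
      case (step r g w)
      then obtain A where A: "\<And>x. x \<in> C \<Longrightarrow> \<bar>w \<bullet> (x, 1)\<bar> \<le> A * h0 x" by blast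
      have "\<bar>(r *\<^sub>R g + w) \<bullet> (x, 1)\<bar> \<le> (\<bar>r\<bar> + A) * h0 x" if x: "x \<in> C" for x
      proof -
        have "g \<bullet> (x, 1) \<le> h0 x"
          unfolding h0_def using B0 x by (intro member_le_sum[OF \<open>g \<in> B\<close> _ fin]) auto
        then have "\<bar>r\<bar> * \<bar>g \<bullet> (x, 1)\<bar> \<le> \<bar>r\<bar> * h0 x"
          using B0[OF \<open>g \<in> B\<close> x] by (intro mult_left_mono) auto
        then have "\<bar>r * (g \<bullet> (x, 1))\<bar> \<le> \<bar>r\<bar> * h0 x" by (simp add: abs_mult)
        then show ?thesis
          using A[OF x] abs_triangle_ineq[of "r * (g \<bullet> (x, 1))" "w \<bullet> (x, 1)"]
          by (simp add: inner_add_left distrib_right)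
      qed
      then show ?case by blast
    qed
  qed
  have "\<exists>A. \<forall>x\<in>C. \<bar>x $ i\<bar> \<le> A * h0 x" for i
    using dom[of "(axis i 1, 0)"] by (simp add: inner_Pair inner_axis')
  then obtain A where A: "\<And>i x. x \<in> C \<Longrightarrow> \<bar>x $ i\<bar> \<le> A i * h0 x" by metis
  have h0nn: "0 \<le> h0 x" if "x \<in> C" for x
    unfolding h0_def using B0 that by (intro sum_nonneg) auto
  define c where "c = fst (\<Sum>B)"
  define \<beta>0 where "\<beta>0 = snd (\<Sum>B)"
  have h0: "h0 x = c \<bullet> x + \<beta>0" for x
    by (simp add: h0_def c_def \<beta>0_def flip: inner_sum_left) (simp add: inner_prod_def)
  \<comment> \<open>Enlarging the constant term keeps the domination; it makes the function strictly positive on \<open>C\<close>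
    and the constant term positive, so that the projective map below is invertible.\<close>
  define \<beta> where "\<beta> = \<beta>0 + \<bar>\<beta>0\<bar> + 1"
  have h: "h0 x \<le> c \<bullet> x + \<beta>" "0 < c \<bullet> x + \<beta>" if "x \<in> C" for x
    using h0nn[OF that] by (auto simp: h0 \<beta>_def)
  have "norm x \<le> (\<Sum>i\<in>UNIV. \<bar>A i\<bar>) * (c \<bullet> x + \<beta>)" if "x \<in> C" for x
  proof -
    have "norm x \<le> (\<Sum>i\<in>UNIV. \<bar>x $ i\<bar>)" by (rule norm_le_l1_cart)
    also have "\<dots> \<le> (\<Sum>i\<in>UNIV. \<bar>A i\<bar> * (c \<bullet> x + \<beta>))"
    proof (rule sum_mono)
      fix i
      have "\<bar>x $ i\<bar> \<le> A i * h0 x" using A that by blast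
      also have "\<dots> \<le> \<bar>A i\<bar> * (c \<bullet> x + \<beta>)"
        using h[OF that] h0nn[OF that] by (intro mult_mono) auto
      finally show "\<bar>x $ i\<bar> \<le> \<bar>A i\<bar> * (c \<bullet> x + \<beta>)" .
    qed
    finally show ?thesis by (simp add: sum_distrib_right)
  qed
  moreover have "0 < \<beta>" by (simp add: \<beta>_def)
  ultimately show ?thesis using that h(2) by blast
qed

text \<open>
  The projective map \<open>x \<mapsto> x / (c \<bullet> x + \<beta>)\<close> with positive denominator on \<open>C\<close>; it is invertible since
  \<open>\<beta> \<noteq> 0\<close>, with inverse \<open>y \<mapsto> \<beta> y / (1 - c \<bullet> y)\<close>.
\<close>

locale projective_chart =
  fixes C :: "(real ^ 'n) set" and c :: "real ^ 'n" and \<beta> :: real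
  assumes C: "open C" "convex C" and \<beta>: "0 < \<beta>" and pos: "\<And>x. x \<in> C \<Longrightarrow> 0 < c \<bullet> x + \<beta>"
begin

definition rescale :: "real ^ 'n \<Rightarrow> real ^ 'n" where
  "rescale x = x /\<^sub>R (c \<bullet> x + \<beta>)"

lemma rescale_denominator:
  assumes "x \<in> C"
  shows "1 - c \<bullet> rescale x = \<beta> / (c \<bullet> x + \<beta>)"
  using pos[OF assms] by (simp add: rescale_def field_simps)

lemma unrescale_rescale:
  assumes "x \<in> C"
  shows "(\<beta> / (1 - c \<bullet> rescale x)) *\<^sub>R rescale x = x"
  using pos[OF assms] \<beta> by (simp add: rescale_denominator[OF assms]) (simp add: rescale_def)

lemma inj_on_rescale: "inj_on rescale C"
  by (metis inj_onI unrescale_rescale)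

lemma rescale_image:
  "rescale ` C = {y. 0 < 1 - c \<bullet> y \<and> (\<beta> / (1 - c \<bullet> y)) *\<^sub>R y \<in> C}"
proof
  show "rescale ` C \<subseteq> {y. 0 < 1 - c \<bullet> y \<and> (\<beta> / (1 - c \<bullet> y)) *\<^sub>R y \<in> C}"
  proof clarify
    fix x assume x: "x \<in> C"
    have "0 < 1 - c \<bullet> rescale x"
      unfolding rescale_denominator[OF x] using \<beta> pos[OF x] by simp
    moreover have "(\<beta> / (1 - c \<bullet> rescale x)) *\<^sub>R rescale x \<in> C"
      unfolding unrescale_rescale[OF x] by (rule x)
    ultimately show "0 < 1 - c \<bullet> rescale x \<and> (\<beta> / (1 - c \<bullet> rescale x)) *\<^sub>R rescale x \<in> C" ..
  qed
  show "{y. 0 < 1 - c \<bullet> y \<and> (\<beta> / (1 - c \<bullet> y)) *\<^sub>R y \<in> C} \<subseteq> rescale ` C"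
  proof clarify
    fix y assume y: "0 < 1 - c \<bullet> y" "(\<beta> / (1 - c \<bullet> y)) *\<^sub>R y \<in> C"
    have "c \<bullet> ((\<beta> / (1 - c \<bullet> y)) *\<^sub>R y) + \<beta> = \<beta> / (1 - c \<bullet> y)"
      using y(1) by (simp add: field_simps)
    then have "y = rescale ((\<beta> / (1 - c \<bullet> y)) *\<^sub>R y)"
      unfolding rescale_def using y(1) \<beta> by simp
    then show "y \<in> rescale ` C" using y(2) by blast
  qed
qed

lemma open_rescale_image: "open (rescale ` C)"
proof -
  let ?U = "{y. 0 < 1 - c \<bullet> y}"
  have "open ?U" by (intro open_Collect_less continuous_intros)
  then have "open (?U \<inter> (\<lambda>y. (\<beta> / (1 - c \<bullet> y)) *\<^sub>R y) -` C)"
    using C(1) by (intro continuous_open_preimage) (auto intro!: continuous_intros)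
  also have "?U \<inter> (\<lambda>y. (\<beta> / (1 - c \<bullet> y)) *\<^sub>R y) -` C = rescale ` C"
    unfolding rescale_image by blast
  finally show ?thesis .
qed

text \<open>
  A convex combination of the images is the image of the combination whose weights are first divided by
  the denominators and then normalised to total weight \<open>1\<close>.
\<close>

lemma convex_rescale_image: "convex (rescale ` C)"
proof (rule convexI)
  fix y1 y2 and u v :: real
  assume "y1 \<in> rescale ` C" "y2 \<in> rescale ` C" and uv: "0 \<le> u" "0 \<le> v" "u + v = 1"
  then obtain x1 x2 where x: "x1 \<in> C" "x2 \<in> C" "y1 = rescale x1" "y2 = rescale x2" by blast
  define h1 where "h1 = c \<bullet> x1 + \<beta>"
  define h2 where "h2 = c \<bullet> x2 + \<beta>"
  have h: "0 < h1" "0 < h2" using x pos by (auto simp: h1_def h2_def)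
  define w where "w = u / h1 + v / h2"
  have w: "0 < w"
    using uv h by (cases "u = 0") (auto simp: w_def intro!: add_pos_nonneg)
  define z where "z = (u / h1 / w) *\<^sub>R x1 + (v / h2 / w) *\<^sub>R x2"
  have sum1: "u / h1 / w + v / h2 / w = 1"
    using w unfolding add_divide_distrib[symmetric] w_def[symmetric] by simp
  then have "z \<in> C"
    unfolding z_def using C(2) x uv h w by (intro convexD) auto
  moreover have "c \<bullet> z + \<beta> = 1 / w"
  proof -
    have "c \<bullet> z + \<beta> = (u / h1 / w) * (c \<bullet> x1) + (v / h2 / w) * (c \<bullet> x2)
        + (u / h1 / w + v / h2 / w) * \<beta>"
      unfolding sum1 by (simp add: z_def inner_add_right)
    also have "\<dots> = (u / h1 / w) * (c \<bullet> x1 + \<beta>) + (v / h2 / w) * (c \<bullet> x2 + \<beta>)"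
      by (simp only: ring_distribs ac_simps)
    also have "\<dots> = (u + v) / w"
      using h by (simp add: add_divide_distrib flip: h1_def h2_def)
    finally show ?thesis using uv by simp
  qed
  then have "rescale z = w *\<^sub>R z" by (simp add: rescale_def)
  moreover have "w *\<^sub>R z = (u / h1) *\<^sub>R x1 + (v / h2) *\<^sub>R x2"
    using w by (simp add: z_def scaleR_add_right)
  moreover have "u *\<^sub>R y1 = (u / h1) *\<^sub>R x1" "v *\<^sub>R y2 = (v / h2) *\<^sub>R x2"
    by (simp_all add: x(3,4) rescale_def h1_def h2_def divide_inverse)
  ultimately show "u *\<^sub>R y1 + v *\<^sub>R y2 \<in> rescale ` C"
    by (metis imageI)
qed

text \<open>
  Write \<open>h x = c \<bullet> x + \<beta>\<close>.  The positive affine functions \<open>g\<close> on \<open>C\<close> and \<open>g'\<close> on the image correspond to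
  each other by \<open>g x = h x * g' (rescale x)\<close>, so the maxima that describe the boundary ratios differ by
  the factor \<open>h p / h q\<close>.
\<close>

lemma boundary_ratio_rescale:
  assumes pq: "p \<in> C" "q \<in> C" "p \<noteq> q"
  shows "boundary_ratio C p q =
    (c \<bullet> p + \<beta>) / (c \<bullet> q + \<beta>) * boundary_ratio (rescale ` C) (rescale p) (rescale q)"
proof (rule antisym)
  define R where "R = boundary_ratio (rescale ` C) (rescale p) (rescale q)"
  have ne: "rescale p \<noteq> rescale q" using pq inj_on_rescale by (auto dest: inj_onD)
  have hp: "0 < c \<bullet> p + \<beta>" and hq: "0 < c \<bullet> q + \<beta>" using pos pq by auto
  show "boundary_ratio C p q \<le> (c \<bullet> p + \<beta>) / (c \<bullet> q + \<beta>) * R"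
  proof (rule boundary_ratio_le[OF C pq])
    fix a b assume g: "\<And>x. x \<in> C \<Longrightarrow> 0 < a \<bullet> x + b"
    have eq: "(a - (b / \<beta>) *\<^sub>R c) \<bullet> rescale x + b / \<beta> = (a \<bullet> x + b) / (c \<bullet> x + \<beta>)"
      if "x \<in> C" for x
    proof -
      have "(a - (b / \<beta>) *\<^sub>R c) \<bullet> rescale x + b / \<beta> = a \<bullet> rescale x + b / \<beta> * (1 - c \<bullet> rescale x)"
        by (simp add: algebra_simps)
      also have "\<dots> = (a \<bullet> x + b) / (c \<bullet> x + \<beta>)"
      proof -
        have "b / \<beta> * (\<beta> / (c \<bullet> x + \<beta>)) = b / (c \<bullet> x + \<beta>)" using \<beta> by simp
        moreover have "a \<bullet> rescale x = (a \<bullet> x) / (c \<bullet> x + \<beta>)"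
          by (simp add: rescale_def divide_inverse mult.commute)
        ultimately show ?thesis
          unfolding rescale_denominator[OF that] by (simp only: add_divide_distrib)
      qed
      finally show ?thesis .
    qed
    have "0 < (a - (b / \<beta>) *\<^sub>R c) \<bullet> y + b / \<beta>" if "y \<in> rescale ` C" for y
      using that g pos by (auto simp: eq)
    from boundary_ratio_ge[OF open_rescale_image convex_rescale_image imageI[OF pq(1)]
        imageI[OF pq(2)] ne less_imp_le[OF this]]
    have "(a \<bullet> p + b) / (c \<bullet> p + \<beta>) \<le> R * ((a \<bullet> q + b) / (c \<bullet> q + \<beta>))"
      unfolding R_def eq[OF pq(1)] eq[OF pq(2)] .
    then have "a \<bullet> p + b \<le> R * ((a \<bullet> q + b) / (c \<bullet> q + \<beta>)) * (c \<bullet> p + \<beta>)"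
      by (simp only: pos_divide_le_eq[OF hp])
    then show "a \<bullet> p + b \<le> (c \<bullet> p + \<beta>) / (c \<bullet> q + \<beta>) * R * (a \<bullet> q + b)"
      by (simp add: mult_ac)
  qed
  have "R \<le> (c \<bullet> q + \<beta>) / (c \<bullet> p + \<beta>) * boundary_ratio C p q"
    unfolding R_def
  proof (rule boundary_ratio_le[OF open_rescale_image convex_rescale_image imageI[OF pq(1)] imageI[OF pq(2)] ne])
    fix a b assume g: "\<And>y. y \<in> rescale ` C \<Longrightarrow> 0 < a \<bullet> y + b"
    have eq: "(a + b *\<^sub>R c) \<bullet> x + b * \<beta> = (c \<bullet> x + \<beta>) * (a \<bullet> rescale x + b)" if "x \<in> C" for x
    proof -
      have "(c \<bullet> x + \<beta>) * (a \<bullet> rescale x) = a \<bullet> x"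
        using pos[OF that] by (simp add: rescale_def)
      then show ?thesis
        by (simp only: distrib_left inner_add_left inner_scaleR_left) (simp add: algebra_simps)
    qed
    have "0 \<le> (a + b *\<^sub>R c) \<bullet> x + b * \<beta>" if "x \<in> C" for x
      unfolding eq[OF that] using g[OF imageI[OF that]] pos[OF that] by simp
    from boundary_ratio_ge[OF C pq this]
    have "(c \<bullet> p + \<beta>) * (a \<bullet> rescale p + b)
      \<le> boundary_ratio C p q * ((c \<bullet> q + \<beta>) * (a \<bullet> rescale q + b))"
      unfolding eq[OF pq(1)] eq[OF pq(2)] by simp
    then have "a \<bullet> rescale p + b
      \<le> boundary_ratio C p q * ((c \<bullet> q + \<beta>) * (a \<bullet> rescale q + b)) / (c \<bullet> p + \<beta>)"
      by (simp add: pos_le_divide_eq[OF hp] mult.commute)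
    then show "a \<bullet> rescale p + b
      \<le> (c \<bullet> q + \<beta>) / (c \<bullet> p + \<beta>) * boundary_ratio C p q * (a \<bullet> rescale q + b)"
      by (simp add: mult_ac)
  qed
  then have "(c \<bullet> p + \<beta>) / (c \<bullet> q + \<beta>) * R \<le>
    (c \<bullet> p + \<beta>) / (c \<bullet> q + \<beta>) * ((c \<bullet> q + \<beta>) / (c \<bullet> p + \<beta>) * boundary_ratio C p q)"
    using hp hq by (intro mult_left_mono) auto
  then show "(c \<bullet> p + \<beta>) / (c \<bullet> q + \<beta>) * R \<le> boundary_ratio C p q"
    using hp hq by simp
qed

text \<open>
  The factors \<open>h p / h q\<close> and \<open>h q / h p\<close> of the two boundary ratios cancel.
\<close>

lemma hilbert_dist_rescale:
  assumes "p \<in> C" "q \<in> C"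
  shows "hilbert_dist (rescale ` C) (rescale p) (rescale q) = hilbert_dist C p q"
proof (cases "p = q")
  case False
  then have "rescale p \<noteq> rescale q" using assms inj_on_rescale by (auto dest: inj_onD)
  then show ?thesis
    using False assms boundary_ratio_rescale[of p q] boundary_ratio_rescale[of q p]
      pos[OF assms(1)] pos[OF assms(2)]
    by (simp add: hilbert_dist_def)
qed (simp add: hilbert_dist_def)

lemma projective_unrescale:
  obtains F where "projective_on (rescale ` C) F" "projective_map F ` rescale ` C = C"
proof -
  define F :: "(real ^ 'n) \<times> real \<Rightarrow> (real ^ 'n) \<times> real"
    where "F = (\<lambda>(y, r). (y, (r - c \<bullet> y) / \<beta>))"
  define F' :: "(real ^ 'n) \<times> real \<Rightarrow> (real ^ 'n) \<times> real"
    where "F' = (\<lambda>(x, r). (x, c \<bullet> x + \<beta> * r))"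
  have "linear F"
    by (rule linearI)
      (auto simp: F_def inner_add_right algebra_simps add_divide_distrib diff_divide_distrib)
  moreover have "bij F"
    using \<beta> by (intro o_bij[of F' F]) (auto simp: F_def F'_def fun_eq_iff)
  moreover have "snd (F (rescale x, 1)) \<noteq> 0" if "x \<in> C" for x
    using rescale_denominator[OF that] pos[OF that] \<beta> by (simp add: F_def)
  ultimately have "projective_on (rescale ` C) F"
    by (auto simp: projective_on_def)
  moreover have "projective_map F (rescale x) = x" if "x \<in> C" for x
    using unrescale_rescale[OF that] by (simp add: projective_map_def F_def)
  then have "projective_map F ` rescale ` C = C"
    by (simp add: image_image)
  ultimately show ?thesis using that by blast
qed

end

section \<open>Bi-Lipschitz images of normed spaces\<close>

text \<open>
  The map to the normed space is transported to the bounded model \<open>D\<close>; finitely many exposed points make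
  the closure of \<open>D\<close> a polytope, and the inverse projective map recovers \<open>C\<close>.
\<close>

theorem corollary8:
  fixes C :: "(real ^ 'n) set"
  assumes "hilbert_domain C"
    and "dim (UNIV :: 'v::real_normed_vector set) = CARD('n)"
    and "\<exists>\<phi> :: real ^ 'n \<Rightarrow> 'v. bilipschitz_onto_normed C \<phi>"
  shows "polytopal_domain C"
proof -
  have dom: "C \<noteq> {}" "open C" "convex C"
    using assms(1) by (auto simp: hilbert_domain_def)
  obtain c \<beta> A where h: "0 < \<beta>" "\<And>x. x \<in> C \<Longrightarrow> 0 < c \<bullet> x + \<beta>"
    and A: "\<And>x. x \<in> C \<Longrightarrow> norm x \<le> A * (c \<bullet> x + \<beta>)"
    by (rule line_free_normalising_functional[OF assms(1)]) (rule that)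
  interpret projective_chart C c \<beta>
    using dom(2,3) h by unfold_locales
  define D where "D = rescale ` C"
  have D: "open D" "convex D" "D \<noteq> {}"
    using open_rescale_image convex_rescale_image dom(1)
    by (auto simp: D_def)
  have "bounded D"
  proof (rule boundedI)
    fix y assume "y \<in> D"
    then obtain x where x: "x \<in> C" "y = rescale x" by (auto simp: D_def)
    have "norm y = norm x / (c \<bullet> x + \<beta>)"
      using h(2)[OF x(1)] by (simp add: x(2) rescale_def divide_inverse mult.commute)
    then show "norm y \<le> A"
      using A[OF x(1)] h(2)[OF x(1)] by (simp only: pos_divide_le_eq)
  qed
  then have compact: "compact (closure D)" by simp
  obtain \<phi> :: "real ^ 'n \<Rightarrow> 'v" and L where L: "1 \<le> L"
    and \<phi>: "\<And>p q. p \<in> C \<Longrightarrow> q \<in> C \<Longrightarrow> inverse L * hilbert_dist C p q \<le> norm (\<phi> p - \<phi> q) \<and>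
        norm (\<phi> p - \<phi> q) \<le> L * hilbert_dist C p q"
    using assms(3) unfolding bilipschitz_onto_normed_def by metis
  define \<psi> where "\<psi> = \<phi> \<circ> inv_into C rescale"
  have \<psi>: "\<psi> (rescale p) = \<phi> p" if "p \<in> C" for p
    using that by (simp add: \<psi>_def inj_on_rescale)
  have dist: "hilbert_dist D (rescale p) (rescale q) = hilbert_dist C p q" if "p \<in> C" "q \<in> C" for p q
    using hilbert_dist_rescale[OF that] by (simp add: D_def)
  have "finite {e. {e} exposed_face_of closure D}"
  proof (rule finite_exposed_points[of D L \<psi>])
    show "compact (cball (0::'v) L)" by (rule compact_cball_finite_dim[OF assms(2)])
    fix p q assume "p \<in> D" "q \<in> D"
    then obtain p' q' where pq: "p' \<in> C" "q' \<in> C" "p = rescale p'" "q = rescale q'" by (auto simp: D_def)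
    show "norm (\<psi> p - \<psi> q) \<le> L * hilbert_dist D p q"
      using \<phi>[OF pq(1,2)] pq by (simp add: \<psi> dist)
    show "hilbert_dist D p q \<le> L * norm (\<psi> p - \<psi> q)"
      using \<phi>[OF pq(1,2)] pq L by (simp add: \<psi> dist field_simps)
  qed (use D L in auto)
  then have H: "polytope (convex hull {e. {e} exposed_face_of closure D})"
    by (auto simp: polytope_def)
  have "closure D = closure (convex hull {e. {e} exposed_face_of closure D})"
    using D(2) by (intro compact_convex_eq_closure_hull_exposed_points compact convex_closure)
  also have "\<dots> = convex hull {e. {e} exposed_face_of closure D}"
    by (rule closure_closed[OF polytope_imp_closed[OF H]])
  finally have P: "polytope (closure D)"
    using H by (rule ssubst)
  have int: "interior (closure D) = D"
    using D by (simp add: convex_interior_closure interior_open)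
  obtain F where F: "projective_on D F" "projective_map F ` D = C"
    using projective_unrescale unfolding D_def by blast
  show ?thesis
    unfolding polytopal_domain_def
    using P F D(3) by (intro exI[of _ "closure D"]) (auto simp: int)
qed

end
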